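(* Let $\varepsilon>0$. For all real $X,D\ge1$ and every sequence of complex numbers $\{\xi_n\}_{n\sim X}$, $$\sum_{d\sim D}\Bigg|\sum_{\substack{n\sim X\\ d\mid n}}\xi_n\Bigg|^2\ll_{\varepsilon}\left(XD^{\varepsilon-1}+D\right)\sum_{n\sim X}|\xi_n|^2,$$ where the implied constant depends only on $\varepsilon$.
   Context: The notation $n\sim X$ means that $n$ ranges over the integers with $X\le n\le2X$ (similarly $d\sim D$). *)

theory Defs
  imports Complex_Main
begin

text \<open>The index set of the notation \<open>n \<sim> X\<close>; both endpoints are included.\<close>

definition dyadic :: "real \<Rightarrow> int set" where
  "dyadic X = {n. X \<le> of_int n \<and> of_int n \<le> 2 * X}"

lemma finite_dyadic [simp]: "finite (dyadic X)"
proof (rule finite_subset)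
  show "dyadic X \<subseteq> {\<lceil>X\<rceil>..\<lfloor>2 * X\<rfloor>}"
    by (auto simp: dyadic_def le_floor_iff ceiling_le_iff)
qed simp

end

theory Submission
  imports Defs "HOL-Analysis.Convex" "HOL-Computational_Algebra.Primes"
begin

text \<open>
  By duality it suffices to bound the quadratic form
  \<open>\<Sum>n. (\<Sum>d | n. b d)\<^sup>2 = \<Sum>d d'. b d * b d' * #{n. lcm d d' | n}\<close> in non-negative reals \<open>b d\<close>.
  The count is at most \<open>X * gcd d d' / (d * d') + 1\<close>, and by symmetry the form is at most
  \<open>\<Sum>d. (b d)\<^sup>2 * (\<Sum>d'. X * gcd d d' / D\<^sup>2 + 1)\<close>. Grouping the \<open>d'\<close> by their gcd with \<open>d\<close>
  bounds the inner sum by \<open>3 * X / D\<close> times the number of divisors of \<open>d\<close>, plus \<open>2 * D\<close>; the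
  divisor bound then costs only a power \<open>D\<^sup>\<epsilon>\<close>, however large \<open>X\<close> is.
\<close>

section \<open>The divisor bound\<close>

text \<open>Each divisor splits as \<open>p ^ i * e\<close> with \<open>i \<le> a\<close> and
  \<open>e dvd m\<close>, so the pairs \<open>(i, e)\<close> map onto the divisors. For an upper
  bound the splitting need not be unique.\<close>

lemma card_divisors_prime_power_mult_le:
  fixes p m :: nat
  assumes "prime p" "m > 0"
  shows "card {d. d dvd p ^ a * m} \<le> (a + 1) * card {d. d dvd m}"
proof -
  have "{d. d dvd p ^ a * m} \<subseteq> (\<lambda>(i, e). p ^ i * e) ` ({..a} \<times> {d. d dvd m})"
  proof
    fix d assume "d \<in> {d. d dvd p ^ a * m}"
    then obtain b c where "d = b * c" "b dvd p ^ a" "c dvd m"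
      using division_decomp by blast
    moreover from this obtain i where "i \<le> a" "b = p ^ i"
      using divides_primepow_nat[OF assms(1)] by blast
    ultimately show "d \<in> (\<lambda>(i, e). p ^ i * e) ` ({..a} \<times> {d. d dvd m})" by force
  qed
  moreover have "finite ({..a} \<times> {d. d dvd m})" using assms(2) by simp
  ultimately have "card {d. d dvd p ^ a * m} \<le> card ({..a} \<times> {d. d dvd m})"
    by (rule surj_card_le[rotated])
  then show ?thesis by (simp add: card_cartesian_product)
qed

text \<open>For the small primes. The inequality \<open>1 + x \<le> exp x\<close> at
  \<open>x = a * \<epsilon> * ln 2\<close> bounds both \<open>1\<close> and
  \<open>a * \<epsilon> * ln 2\<close> by \<open>p powr (a * \<epsilon>)\<close>; solving the second
  for \<open>a\<close> and adding gives the constant.\<close>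

lemma Suc_le_powr:
  fixes p \<epsilon> :: real
  assumes "\<epsilon> > 0" "p \<ge> 2"
  shows "real a + 1 \<le> (1 + 1 / (\<epsilon> * ln 2)) * p powr (a * \<epsilon>)"
proof -
  have "1 + a * \<epsilon> * ln 2 \<le> exp (a * \<epsilon> * ln 2)" by (rule exp_ge_add_one_self)
  also have "\<dots> = 2 powr (a * \<epsilon>)" by (simp add: powr_def)
  also have "\<dots> \<le> p powr (a * \<epsilon>)" using assms by (intro powr_mono2) auto
  finally have *: "1 + a * \<epsilon> * ln 2 \<le> p powr (a * \<epsilon>)" .
  have pos: "\<epsilon> * ln 2 > 0" using assms by simp
  have "real a * (\<epsilon> * ln 2) \<le> p powr (a * \<epsilon>)" using * by (simp add: mult.assoc)
  then have "real a \<le> p powr (a * \<epsilon>) / (\<epsilon> * ln 2)"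
    using pos by (simp add: pos_le_divide_eq)
  moreover have "0 \<le> a * \<epsilon> * ln 2" using assms by simp
  with * have "1 \<le> p powr (a * \<epsilon>)" by linarith
  ultimately show ?thesis by (simp add: distrib_right)
qed

text \<open>The threshold is the point where \<open>p powr \<epsilon>\<close> reaches 2, so that
  \<open>p powr (a * \<epsilon>)\<close> dominates \<open>2 ^ a\<close> and hence
  \<open>a + 1\<close> without any constant.\<close>

lemma Suc_le_powr_of_large:
  fixes p \<epsilon> :: real
  assumes "\<epsilon> > 0" "p \<ge> 2 powr (1 / \<epsilon>)"
  shows "real a + 1 \<le> p powr (a * \<epsilon>)"
proof -
  have "real a + 1 \<le> 2 ^ a"
    using less_exp[of a] by (metis Suc_leI add.commute of_nat_Suc of_nat_le_iff of_nat_numeral of_nat_power)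
  also have "\<dots> = (2 powr (1 / \<epsilon>)) powr (a * \<epsilon>)"
    using assms by (simp add: powr_powr powr_realpow)
  also have "\<dots> \<le> p powr (a * \<epsilon>)" using assms by (intro powr_mono2) auto
  finally show ?thesis .
qed

text \<open>
  Only the primes below \<open>2 powr (1 / \<epsilon>)\<close> cost a constant factor, and there are boundedly many.
\<close>

lemma card_divisors_le_powr_aux:
  fixes n :: nat and \<epsilon> :: real
  assumes "\<epsilon> > 0" "n > 0"
  shows "real (card {d. d dvd n}) \<le>
    (1 + 1 / (\<epsilon> * ln 2)) ^ card {p \<in> prime_factors n. p < 2 powr (1 / \<epsilon>)} * n powr \<epsilon>"
  using assms(2)
proof (induction n rule: less_induct)
  case (less n)
  define K where "K = 1 + 1 / (\<epsilon> * ln 2)"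
  define B where "B n = {p \<in> prime_factors n. p < 2 powr (1 / \<epsilon>)}" for n :: nat
  have fin: "finite (B n)" for n by (simp add: B_def)
  show ?case
  proof (cases "n = 1")
    case True
    then show ?thesis by simp
  next
    case False
    then obtain p where p: "prime p" "p dvd n" using prime_factor_nat by blast
    \<comment> \<open>The full power of \<open>p\<close> is split off, so \<open>p\<close> does not
      recur in \<open>m\<close> and each small prime costs its factor \<open>K\<close> only
      once.\<close>
    obtain m where m: "n = p ^ multiplicity p n * m" "\<not> p dvd m"
      using multiplicity_decompose'[of n p] less.prems p by (metis not_prime_unit not_gr0)
    define a where "a = multiplicity p n"
    have n_eq: "n = p ^ a * m" unfolding a_def by (rule m(1))
    have "a > 0" using p less.prems by (simp add: a_def prime_multiplicity_gt_zero_iff)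
    have "m > 0" using less.prems n_eq by (cases m) auto
    have "p > 1" using p prime_gt_1_nat by blast
    then have "p ^ a > 1" using \<open>a > 0\<close> by (rule one_less_power)
    with \<open>m > 0\<close> have "m < n" using n_eq by simp
    have IH: "real (card {d. d dvd m}) \<le> K ^ card (B m) * m powr \<epsilon>"
      using less.IH[OF \<open>m < n\<close> \<open>m > 0\<close>] by (simp add: K_def B_def)
    have B_sub: "B m \<subseteq> B n"
      using n_eq less.prems \<open>m > 0\<close> by (auto simp: B_def prime_factors_dvd)
    have "p \<notin> B m" using m by (auto simp: B_def)
    have "K \<ge> 1" using assms(1) by (simp add: K_def)
    \<comment> \<open>The factor \<open>a + 1\<close> has to be absorbed. A small \<open>p\<close>
      enlarges \<open>B\<close> and so supplies one more factor \<open>K\<close>; for a large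
      \<open>p\<close> the power \<open>p powr (a * \<epsilon>)\<close> suffices alone.\<close>
    have step: "(real a + 1) * K ^ card (B m) \<le> K ^ card (B n) * p powr (a * \<epsilon>)"
    proof (cases "p < 2 powr (1 / \<epsilon>)")
      case True
      then have "insert p (B m) \<subseteq> B n"
        using B_sub p less.prems by (auto simp: B_def prime_factors_dvd)
      then have "Suc (card (B m)) \<le> card (B n)"
        using card_mono[OF fin] \<open>p \<notin> B m\<close> fin by (metis card_insert_disjoint)
      then have "K * K ^ card (B m) \<le> K ^ card (B n)"
        using power_increasing[OF _ \<open>K \<ge> 1\<close>] by (metis power_Suc)
      moreover have "real a + 1 \<le> K * p powr (a * \<epsilon>)"
        using Suc_le_powr[OF assms(1), of p a] \<open>p > 1\<close> by (simp add: K_def)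
      then have "(real a + 1) * K ^ card (B m) \<le> K * p powr (a * \<epsilon>) * K ^ card (B m)"
        using \<open>K \<ge> 1\<close> by (intro mult_right_mono) auto
      moreover have "K * K ^ card (B m) * p powr (a * \<epsilon>) \<le> K ^ card (B n) * p powr (a * \<epsilon>)"
        using calculation(1) by (intro mult_right_mono) auto
      ultimately show ?thesis by (simp add: algebra_simps)
    next
      case False
      then have "real a + 1 \<le> p powr (a * \<epsilon>)"
        by (intro Suc_le_powr_of_large[OF assms(1)]) auto
      moreover have "K ^ card (B m) \<le> K ^ card (B n)"
        using card_mono[OF fin B_sub] \<open>K \<ge> 1\<close> by (rule power_increasing)
      ultimately have "(real a + 1) * K ^ card (B m) \<le> p powr (a * \<epsilon>) * K ^ card (B n)"
        using \<open>K \<ge> 1\<close> by (intro mult_mono) auto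
      then show ?thesis by (simp add: mult.commute)
    qed
    have "card {d. d dvd n} \<le> (a + 1) * card {d. d dvd m}"
      unfolding n_eq by (rule card_divisors_prime_power_mult_le[OF p(1) \<open>m > 0\<close>])
    then have "real (card {d. d dvd n}) \<le> real ((a + 1) * card {d. d dvd m})"
      by (rule of_nat_mono)
    also have "\<dots> = (real a + 1) * card {d. d dvd m}" by (simp add: algebra_simps)
    also have "\<dots> \<le> (real a + 1) * (K ^ card (B m) * m powr \<epsilon>)"
      using IH by (intro mult_left_mono) auto
    also have "\<dots> = ((real a + 1) * K ^ card (B m)) * m powr \<epsilon>" by simp
    also have "\<dots> \<le> (K ^ card (B n) * p powr (a * \<epsilon>)) * m powr \<epsilon>"
      using step by (intro mult_right_mono) auto
    also have "\<dots> = K ^ card (B n) * n powr \<epsilon>"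
    proof -
      have "real n powr \<epsilon> = (real p ^ a) powr \<epsilon> * real m powr \<epsilon>"
        unfolding n_eq by (simp add: powr_mult)
      moreover have "(real p ^ a) powr \<epsilon> = p powr (a * \<epsilon>)"
        using \<open>p > 1\<close> by (simp add: powr_realpow[symmetric] powr_powr)
      ultimately show ?thesis by simp
    qed
    finally show ?thesis by (simp add: K_def B_def)
  qed
qed

text \<open>The exponent of \<open>K\<close> in the previous bound counts primes below
  \<open>2 powr (1 / \<epsilon>)\<close>, hence is at most the number \<open>N\<close> of naturals
  below it, which depends on \<open>\<epsilon>\<close> only.\<close>

lemma card_divisors_le_powr:
  fixes \<epsilon> :: real
  assumes "\<epsilon> > 0"
  obtains C where "C > 0" "\<And>n. n > 0 \<Longrightarrow> real (card {d::nat. d dvd n}) \<le> C * n powr \<epsilon>"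
proof
  define K where "K = 1 + 1 / (\<epsilon> * ln 2)"
  define N where "N = nat \<lceil>2 powr (1 / \<epsilon>)\<rceil>"
  have "K \<ge> 1" using assms by (simp add: K_def)
  then show "K ^ N > 0" by simp
  fix n :: nat assume "n > 0"
  have "{p \<in> prime_factors n. p < 2 powr (1 / \<epsilon>)} \<subseteq> {..<N}"
    by (auto simp: N_def) linarith
  then have "card {p \<in> prime_factors n. p < 2 powr (1 / \<epsilon>)} \<le> N"
    using card_mono[of "{..<N}"] by fastforce
  then have "K ^ card {p \<in> prime_factors n. p < 2 powr (1 / \<epsilon>)} \<le> K ^ N"
    using \<open>K \<ge> 1\<close> by (rule power_increasing)
  then have "K ^ card {p \<in> prime_factors n. p < 2 powr (1 / \<epsilon>)} * n powr \<epsilon> \<le> K ^ N * n powr \<epsilon>"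
    by (rule mult_right_mono) simp
  then show "real (card {d. d dvd n}) \<le> K ^ N * n powr \<epsilon>"
    using card_divisors_le_powr_aux[OF assms \<open>n > 0\<close>] by (simp add: K_def)
qed

lemma card_int_divisors:
  fixes n :: int
  assumes "n > 0"
  shows "card {g. 0 < g \<and> g dvd n} = card {d. d dvd nat n}"
proof -
  have "{g. 0 < g \<and> g dvd n} = int ` {d. d dvd nat n}"
  proof (intro set_eqI iffI)
    fix g assume "g \<in> {g. 0 < g \<and> g dvd n}"
    then have "g = int (nat g)" "nat g dvd nat n" using assms by (auto simp: nat_dvd_iff)
    then show "g \<in> int ` {d. d dvd nat n}" by blast
  next
    fix g assume "g \<in> int ` {d. d dvd nat n}"
    then obtain d where "g = int d" "d dvd nat n" by blast
    moreover from this have "d > 0" using assms by (auto intro!: Nat.gr0I)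
    moreover have "int d dvd int (nat n)" using \<open>d dvd nat n\<close> by (simp only: int_dvd_int_iff)
    ultimately show "g \<in> {g. 0 < g \<and> g dvd n}" using assms by simp
  qed
  then show ?thesis by (simp add: card_image)
qed

section \<open>Counting in dyadic ranges\<close>

lemma dyadic_pos: "X > 0 \<Longrightarrow> n \<in> dyadic X \<Longrightarrow> n > 0"
  unfolding dyadic_def by (metis (lifting) less_le_trans mem_Collect_eq of_int_0_less_iff)

text \<open>The multiples are \<open>m * k\<close> with \<open>k\<close> in the closed interval from
  \<open>X / m\<close> to \<open>2 * X / m\<close>. Its length is \<open>X / m\<close>, and the
  extra 1 allows for both endpoints being integers.\<close>

lemma card_dyadic_multiples_le:
  fixes m :: int
  assumes "m > 0" "X \<ge> 0"
  shows "real (card {n \<in> dyadic X. m dvd n}) \<le> X / m + 1"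
proof -
  have sub: "{n \<in> dyadic X. m dvd n} \<subseteq> (\<lambda>k. m * k) ` {\<lceil>X / m\<rceil>..\<lfloor>2 * X / m\<rfloor>}"
  proof
    fix n assume "n \<in> {n \<in> dyadic X. m dvd n}"
    then have n: "X \<le> n" "n \<le> 2 * X" "m dvd n" by (auto simp: dyadic_def)
    then obtain k where "n = m * k" by blast
    with n have k: "n = m * k" "X \<le> m * k" "m * k \<le> 2 * X" by auto
    then have "X / m \<le> k" "k \<le> 2 * X / m"
      using assms by (auto simp: field_simps)
    then show "n \<in> (\<lambda>k. m * k) ` {\<lceil>X / m\<rceil>..\<lfloor>2 * X / m\<rfloor>}"
      using k by (auto simp: le_floor_iff ceiling_le_iff)
  qed
  then have "card {n \<in> dyadic X. m dvd n} \<le> card {\<lceil>X / m\<rceil>..\<lfloor>2 * X / m\<rfloor>}"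
    by (rule surj_card_le[rotated]) simp
  also have "\<dots> = nat (\<lfloor>2 * X / m\<rfloor> + 1 - \<lceil>X / m\<rceil>)" by simp
  finally have "real (card {n \<in> dyadic X. m dvd n}) \<le> nat (\<lfloor>2 * X / m\<rfloor> + 1 - \<lceil>X / m\<rceil>)"
    by simp
  moreover have "X / m \<ge> 0" using assms by simp
  moreover have "2 * X / m = 2 * (X / m)" by simp
  ultimately show ?thesis by linarith
qed

text \<open>The gcd is one of the common divisors \<open>g\<close> of \<open>d\<close> and
  \<open>e\<close>, so it is at most their sum. After interchanging the sums, each divisor
  \<open>g\<close> of \<open>d\<close> contributes at most \<open>g * (D / g + 1) = D + g\<close>,
  which is at most \<open>3 * D\<close> because \<open>g \<le> d \<le> 2 * D\<close>.\<close>

lemma sum_gcd_dyadic_le: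
  assumes "D \<ge> 1" "d \<in> dyadic D"
  shows "(\<Sum>e\<in>dyadic D. real_of_int (gcd d e)) \<le> 3 * D * card {g. 0 < g \<and> g dvd d}"
proof -
  have "d > 0" using dyadic_pos assms by force
  define G where "G = {g. 0 < g \<and> g dvd d}"
  have G_le: "g \<le> d" if "g \<in> G" for g
    using that \<open>d > 0\<close> by (auto simp: G_def intro: zdvd_imp_le)
  have "G \<subseteq> {0..d}" using G_le by (auto simp: G_def)
  then have "finite G" by (rule finite_subset) simp
  have "(\<Sum>e\<in>dyadic D. real_of_int (gcd d e)) \<le> (\<Sum>e\<in>dyadic D. \<Sum>g\<in>G. real_of_int (if g dvd e then g else 0))"
  proof (rule sum_mono)
    fix e
    have "gcd d e \<in> G" using \<open>d > 0\<close> by (simp add: G_def)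
    then have "(\<Sum>g\<in>{gcd d e}. real_of_int (if g dvd e then g else 0))
        \<le> (\<Sum>g\<in>G. real_of_int (if g dvd e then g else 0))"
      using \<open>finite G\<close> by (intro sum_mono2) (auto simp: G_def)
    then show "real_of_int (gcd d e) \<le> (\<Sum>g\<in>G. real_of_int (if g dvd e then g else 0))" by simp
  qed
  also have "\<dots> = (\<Sum>g\<in>G. \<Sum>e\<in>dyadic D. real_of_int (if g dvd e then g else 0))"
    by (rule sum.swap)
  also have "\<dots> = (\<Sum>g\<in>G. g * real (card {e \<in> dyadic D. g dvd e}))"
  proof (rule sum.cong[OF refl])
    fix g
    have "(\<Sum>e\<in>dyadic D. real_of_int (if g dvd e then g else 0)) = (\<Sum>e\<in>{e \<in> dyadic D. g dvd e}. real_of_int g)"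
      by (subst sum.inter_filter) (simp_all add: if_distrib cong: if_cong)
    then show "(\<Sum>e\<in>dyadic D. real_of_int (if g dvd e then g else 0)) = g * real (card {e \<in> dyadic D. g dvd e})"
      by (simp only: sum_constant mult.commute)
  qed
  also have "\<dots> \<le> (\<Sum>g\<in>G. 3 * D)"
  proof (rule sum_mono)
    fix g assume g: "g \<in> G"
    then have "g > 0" by (simp add: G_def)
    have "real_of_int g \<le> 2 * D" using G_le[OF g] assms(2) by (auto simp: dyadic_def)
    have "g * real (card {e \<in> dyadic D. g dvd e}) \<le> g * (D / g + 1)"
      using card_dyadic_multiples_le[OF \<open>g > 0\<close>, of D] assms \<open>g > 0\<close> by (intro mult_left_mono) auto
    also have "\<dots> = D + g" using \<open>g > 0\<close> by (simp add: field_simps)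
    finally show "g * real (card {e \<in> dyadic D. g dvd e}) \<le> 3 * D"
      using \<open>real_of_int g \<le> 2 * D\<close> by simp
  qed
  finally show ?thesis by (simp add: G_def mult.commute)
qed

section \<open>The dual quadratic form\<close>

text \<open>A form of Schur's test: \<open>b x * b y\<close> is at most the mean of the two squares,
  and by the symmetry of \<open>w\<close> both halves give the same sum, in which only the row sums
  of \<open>w\<close> remain.\<close>

lemma sum_symmetric_form_le:
  fixes b :: "'a \<Rightarrow> real" and w :: "'a \<Rightarrow> 'a \<Rightarrow> real"
  assumes "\<And>x y. x \<in> A \<Longrightarrow> y \<in> A \<Longrightarrow> w x y \<ge> 0" "\<And>x y. w x y = w y x"
    and "\<And>x. x \<in> A \<Longrightarrow> (\<Sum>y\<in>A. w x y) \<le> K"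
  shows "(\<Sum>x\<in>A. \<Sum>y\<in>A. b x * b y * w x y) \<le> K * (\<Sum>x\<in>A. (b x)\<^sup>2)"
proof -
  have "(\<Sum>x\<in>A. \<Sum>y\<in>A. b x * b y * w x y)
      \<le> (\<Sum>x\<in>A. \<Sum>y\<in>A. (b x)\<^sup>2 * w x y / 2 + (b y)\<^sup>2 * w x y / 2)"
  proof (intro sum_mono)
    fix x y assume "x \<in> A" "y \<in> A"
    moreover have "b x * b y \<le> ((b x)\<^sup>2 + (b y)\<^sup>2) / 2"
      using sum_squares_bound[of "b x" "b y"] by simp
    ultimately have "b x * b y * w x y \<le> ((b x)\<^sup>2 + (b y)\<^sup>2) / 2 * w x y"
      using assms(1) by (intro mult_right_mono) auto
    then show "b x * b y * w x y \<le> (b x)\<^sup>2 * w x y / 2 + (b y)\<^sup>2 * w x y / 2"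
      by (simp add: algebra_simps add_divide_distrib)
  qed
  also have "\<dots> = (\<Sum>x\<in>A. \<Sum>y\<in>A. (b x)\<^sup>2 * w x y / 2) + (\<Sum>x\<in>A. \<Sum>y\<in>A. (b y)\<^sup>2 * w x y / 2)"
    by (simp add: sum.distrib)
  also have "(\<Sum>x\<in>A. \<Sum>y\<in>A. (b y)\<^sup>2 * w x y / 2) = (\<Sum>x\<in>A. \<Sum>y\<in>A. (b x)\<^sup>2 * w x y / 2)"
    by (subst sum.swap) (simp add: assms(2))
  also have "(\<Sum>x\<in>A. \<Sum>y\<in>A. (b x)\<^sup>2 * w x y / 2) + \<dots> = (\<Sum>x\<in>A. (b x)\<^sup>2 * (\<Sum>y\<in>A. w x y))"
    by (simp only: sum_distrib_left field_sum_of_halves flip: sum.distrib)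
  also have "\<dots> \<le> (\<Sum>x\<in>A. (b x)\<^sup>2 * K)"
    using assms(3) by (intro sum_mono mult_left_mono) auto
  finally show ?thesis by (simp add: sum_distrib_left mult.commute)
qed

lemma sum_divisor_sums_squared_le:
  fixes b :: "int \<Rightarrow> real"
  assumes "X \<ge> 1" "D \<ge> 1" "\<And>d. b d \<ge> 0"
    and T: "\<And>d. d \<in> dyadic D \<Longrightarrow> real (card {g. 0 < g \<and> g dvd d}) \<le> T"
  shows "(\<Sum>n\<in>dyadic X. (\<Sum>d\<in>{d \<in> dyadic D. d dvd n}. b d)\<^sup>2)
      \<le> (3 * X * T / D + 2 * D) * (\<Sum>d\<in>dyadic D. (b d)\<^sup>2)"
proof -
  \<comment> \<open>This majorises the count \<open>X / lcm d e + 1\<close>, since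
    \<open>1 / lcm d e = gcd d e / (d * e)\<close> and both \<open>d\<close> and \<open>e\<close>
    are at least \<open>D\<close>.\<close>
  define w where "w d e = X / D\<^sup>2 * gcd d e + 1" for d e :: int
  have "(\<Sum>n\<in>dyadic X. (\<Sum>d\<in>{d \<in> dyadic D. d dvd n}. b d)\<^sup>2)
      = (\<Sum>n\<in>dyadic X. \<Sum>d\<in>dyadic D. \<Sum>e\<in>dyadic D. if lcm d e dvd n then b d * b e else 0)"
    \<comment> \<open>In the expanded square a pair survives when \<open>d\<close> and
      \<open>e\<close> both divide \<open>n\<close>, that is, when \<open>lcm d e\<close>
      does.\<close>
    by (auto simp: power2_eq_square sum_product sum.inter_filter intro!: sum.cong)
  also have "\<dots> = (\<Sum>d\<in>dyadic D. \<Sum>e\<in>dyadic D. \<Sum>n\<in>dyadic X. if lcm d e dvd n then b d * b e else 0)"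
    by (subst sum.swap, rule sum.cong[OF refl], subst sum.swap, rule refl)
  also have "\<dots> = (\<Sum>d\<in>dyadic D. \<Sum>e\<in>dyadic D. b d * b e * card {n \<in> dyadic X. lcm d e dvd n})"
    by (intro sum.cong refl) (simp add: sum.inter_filter[symmetric])
  also have "\<dots> \<le> (\<Sum>d\<in>dyadic D. \<Sum>e\<in>dyadic D. b d * b e * w d e)"
  proof (intro sum_mono mult_left_mono)
    fix d e assume de: "d \<in> dyadic D" "e \<in> dyadic D"
    then have pos: "d > 0" "e > 0" using dyadic_pos assms(2) by force+
    then have "lcm d e > 0" by (simp add: lcm_pos_int)
    have "gcd d e * lcm d e = d * e" using pos by (simp add: prod_gcd_lcm_int)
    then have eq: "real_of_int (gcd d e) * lcm d e = real_of_int d * e" by (metis of_int_mult)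
    have "D * D \<le> real_of_int d * e"
      using de assms(2) by (intro mult_mono) (auto simp: dyadic_def)
    then have "D\<^sup>2 \<le> real_of_int (gcd d e) * lcm d e" by (simp add: eq power2_eq_square)
    then have "X / lcm d e \<le> X / D\<^sup>2 * gcd d e"
      using \<open>lcm d e > 0\<close> assms(1,2) by (simp add: field_simps)
    then show "real (card {n \<in> dyadic X. lcm d e dvd n}) \<le> w d e"
      using card_dyadic_multiples_le[OF \<open>lcm d e > 0\<close>, of X] assms(1) by (simp add: w_def)
  qed (use assms(3) in auto)
  also have "\<dots> \<le> (3 * X * T / D + 2 * D) * (\<Sum>d\<in>dyadic D. (b d)\<^sup>2)"
  proof (rule sum_symmetric_form_le)
    show "w d e = w e d" for d e by (simp add: w_def gcd.commute)
    show "w d e \<ge> 0" for d e using assms(1,2) by (simp add: w_def)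
    fix d assume d: "d \<in> dyadic D"
    have "(\<Sum>e\<in>dyadic D. w d e) = X / D\<^sup>2 * (\<Sum>e\<in>dyadic D. real_of_int (gcd d e)) + card (dyadic D)"
      by (simp add: w_def sum.distrib sum_distrib_left)
    also have "\<dots> \<le> X / D\<^sup>2 * (3 * D * T) + 2 * D"
    proof (intro add_mono mult_left_mono)
      have "3 * D * real (card {g. 0 < g \<and> g dvd d}) \<le> 3 * D * T"
        using T[OF d] assms(2) by (intro mult_left_mono) auto
      then show "(\<Sum>e\<in>dyadic D. real_of_int (gcd d e)) \<le> 3 * D * T"
        using sum_gcd_dyadic_le[OF assms(2) d] by linarith
      \<comment> \<open>The count is at most \<open>D + 1\<close>, and
        \<open>D \<ge> 1\<close>.\<close>
      show "real (card (dyadic D)) \<le> 2 * D"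
        using card_dyadic_multiples_le[of 1 D] assms(2) by simp
    qed (use assms(1) in auto)
    also have "X / D\<^sup>2 * (3 * D * T) = 3 * X * T / D"
      using assms(2) by (simp add: power2_eq_square)
    finally show "(\<Sum>e\<in>dyadic D. w d e) \<le> 3 * X * T / D + 2 * D" .
  qed
  finally show ?thesis .
qed

text \<open>Duality: the assumed inequality is applied with \<open>b d\<close> the modulus of the
  inner sum itself. Interchanging the sums and Cauchy-Schwarz give
  \<open>S\<^sup>2 \<le> Z * (K * S)\<close>, and a factor \<open>S\<close> cancels. Moduli are
  taken before the interchange, so nonnegative real \<open>b\<close> suffice.\<close>

lemma sum_norm_multiples_squared_le:
  fixes \<xi> :: "int \<Rightarrow> complex" and K :: real
  assumes "\<And>b :: int \<Rightarrow> real. (\<And>d. b d \<ge> 0) \<Longrightarrow>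
    (\<Sum>n\<in>A. (\<Sum>d\<in>{d \<in> B. d dvd n}. b d)\<^sup>2) \<le> K * (\<Sum>d\<in>B. (b d)\<^sup>2)"
    and fin: "finite A" "finite B"
    and "K \<ge> 0"
  shows "(\<Sum>d\<in>B. (cmod (\<Sum>n\<in>{n \<in> A. d dvd n}. \<xi> n))\<^sup>2) \<le> K * (\<Sum>n\<in>A. (cmod (\<xi> n))\<^sup>2)"
proof -
  define b where "b d = cmod (\<Sum>n\<in>{n \<in> A. d dvd n}. \<xi> n)" for d
  define S where "S = (\<Sum>d\<in>B. (b d)\<^sup>2)"
  define Z where "Z = (\<Sum>n\<in>A. (cmod (\<xi> n))\<^sup>2)"
  have nonneg: "S \<ge> 0" "Z \<ge> 0" by (simp_all add: S_def Z_def sum_nonneg)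
  have "S \<le> (\<Sum>d\<in>B. b d * (\<Sum>n\<in>{n \<in> A. d dvd n}. cmod (\<xi> n)))"
    unfolding S_def power2_eq_square
    by (intro sum_mono mult_left_mono) (simp_all add: b_def norm_sum)
  also have "\<dots> = (\<Sum>d\<in>B. \<Sum>n\<in>A. if d dvd n then b d * cmod (\<xi> n) else 0)"
    using fin by (intro sum.cong refl) (simp add: sum_distrib_left flip: sum.inter_filter)
  also have "\<dots> = (\<Sum>n\<in>A. cmod (\<xi> n) * (\<Sum>d\<in>{d \<in> B. d dvd n}. b d))"
    using fin by (subst sum.swap) (simp add: sum_distrib_left mult.commute flip: sum.inter_filter)
  finally have "S \<le> (\<Sum>n\<in>A. cmod (\<xi> n) * (\<Sum>d\<in>{d \<in> B. d dvd n}. b d))" .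
  then have "S\<^sup>2 \<le> (\<Sum>n\<in>A. cmod (\<xi> n) * (\<Sum>d\<in>{d \<in> B. d dvd n}. b d))\<^sup>2"
    using nonneg by (intro power_mono) auto
  also have "\<dots> \<le> Z * (\<Sum>n\<in>A. (\<Sum>d\<in>{d \<in> B. d dvd n}. b d)\<^sup>2)"
    unfolding Z_def by (rule Cauchy_Schwarz_ineq_sum)
  also have "\<dots> \<le> Z * (K * S)"
    unfolding S_def using nonneg by (intro mult_left_mono assms(1)) (auto simp: b_def)
  finally have "S * S \<le> (K * Z) * S" by (simp add: power2_eq_square mult_ac)
  then have "S \<le> K * Z"
    \<comment> \<open>Cancelling requires \<open>S > 0\<close>; for \<open>S = 0\<close> the claim
      is the nonnegativity of \<open>K * Z\<close>.\<close>
    using nonneg \<open>K \<ge> 0\<close> by (cases "S = 0") (auto simp: mult_le_cancel_right)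
  then show ?thesis by (simp add: S_def Z_def b_def)
qed

theorem lemma3p1:
  fixes \<epsilon> :: real
  assumes "\<epsilon> > 0"
  shows "\<exists>C>0. \<forall>(X::real) (D::real) (\<xi> :: int \<Rightarrow> complex). X \<ge> 1 \<longrightarrow> D \<ge> 1 \<longrightarrow>
    (\<Sum>d\<in>dyadic D. (cmod (\<Sum>n\<in>{n \<in> dyadic X. d dvd n}. \<xi> n))\<^sup>2)
      \<le> C * (X * D powr (\<epsilon> - 1) + D) * (\<Sum>n\<in>dyadic X. (cmod (\<xi> n))\<^sup>2)"
proof -
  obtain M where M: "M > 0" "\<And>n. n > 0 \<Longrightarrow> real (card {d::nat. d dvd n}) \<le> M * n powr \<epsilon>"
    using card_divisors_le_powr[OF assms] by blast
  \<comment> \<open>The first summand serves the term with \<open>X\<close>, where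
    \<open>2 powr \<epsilon>\<close> arises because \<open>d\<close> may be as large as
    \<open>2 * D\<close>; the second serves \<open>2 * D\<close>.\<close>
  define C where "C = 3 * M * 2 powr \<epsilon> + 2"
  show ?thesis
  proof (intro exI[of _ C] conjI allI impI)
    show "C > 0" using M(1) by (simp add: C_def add_pos_pos)
    fix X D :: real and \<xi> :: "int \<Rightarrow> complex"
    assume X: "X \<ge> 1" and D: "D \<ge> 1"
    define T where "T = M * (2 * D) powr \<epsilon>"
    define K where "K = 3 * X * T / D + 2 * D"
    have "T \<ge> 0" using M(1) by (simp add: T_def)
    have T: "real (card {g. 0 < g \<and> g dvd d}) \<le> T" if d: "d \<in> dyadic D" for d
    proof -
      have "d > 0" using dyadic_pos d D by force
      then have "real (card {g. 0 < g \<and> g dvd d}) \<le> M * real (nat d) powr \<epsilon>"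
        using M(2)[of "nat d"] by (simp add: card_int_divisors)
      also have "\<dots> \<le> T"
        unfolding T_def using M(1) assms d \<open>d > 0\<close>
        by (intro mult_left_mono powr_mono2) (auto simp: dyadic_def)
      finally show ?thesis .
    qed
    have "(\<Sum>d\<in>dyadic D. (cmod (\<Sum>n\<in>{n \<in> dyadic X. d dvd n}. \<xi> n))\<^sup>2)
        \<le> K * (\<Sum>n\<in>dyadic X. (cmod (\<xi> n))\<^sup>2)"
      unfolding K_def using X D \<open>T \<ge> 0\<close>
      by (intro sum_norm_multiples_squared_le sum_divisor_sums_squared_le T) auto
    also have "\<dots> \<le> C * (X * D powr (\<epsilon> - 1) + D) * (\<Sum>n\<in>dyadic X. (cmod (\<xi> n))\<^sup>2)"
    proof (intro mult_right_mono sum_nonneg)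
      \<comment> \<open>Dividing the divisor bound \<open>T\<close> by \<open>D\<close> produces the
        exponent \<open>\<epsilon> - 1\<close>.\<close>
      have "3 * X * T / D = 3 * M * 2 powr \<epsilon> * (X * D powr (\<epsilon> - 1))"
        using D by (simp add: T_def powr_mult powr_diff)
      moreover have "\<dots> \<le> C * (X * D powr (\<epsilon> - 1))"
        using X by (intro mult_right_mono) (auto simp: C_def)
      moreover have "2 * D \<le> C * D"
        using D M(1) by (intro mult_right_mono) (auto simp: C_def)
      ultimately show "K \<le> C * (X * D powr (\<epsilon> - 1) + D)"
        by (simp add: K_def distrib_left)
    qed simp
    finally show "(\<Sum>d\<in>dyadic D. (cmod (\<Sum>n\<in>{n \<in> dyadic X. d dvd n}. \<xi> n))\<^sup>2)
      \<le> C * (X * D powr (\<epsilon> - 1) + D) * (\<Sum>n\<in>dyadic X. (cmod (\<xi> n))\<^sup>2)" .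
  qed
qed

end
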